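(* If $p\in\mathbb{Z}^+$ is prime, then $HJ(p,2)=p$.
   Context: For $k\in\mathbb{Z}^+$ let $[k]=\{1,2,\dots,k\}$. A variable word over $[k]$ of length $n$ is a vector $w(x)\in([k]\cup\{x\})^n$ containing at least one occurrence of $x$; for $a\in[k]$, $w(a)\in[k]^n$ is obtained by replacing every occurrence of $x$ by $a$. The combinatorial line determined by $w(x)$ is $\{w(a):a\in[k]\}$. A (combinatorial) $m$-line (partial combinatorial line of length $m$) in $[k]^n$ is a set of the form $\{w(a):a\in\{i+1,\dots,i+m\}\}$ with $w(x)$ a variable word and $0\le i\le k-m$. For $k_1,k_2\in\mathbb{Z}^+$ and $K=\max(k_1,k_2)$, the off-diagonal Hales-Jewett number $HJ(k_1,k_2)=HJ(k_1,k_2;2)$ is the least positive integer $n$ such that every $2$-coloring of $[K]^n$ contains a monochromatic $k_1$-line of color $1$ or a monochromatic $k_2$-line of color $2$. *)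

theory Defs
  imports "HOL-Library.FuncSet" "HOL-Computational_Algebra.Primes"
begin

definition cube :: "nat \<Rightarrow> nat \<Rightarrow> nat list set" where
  "cube k n = {v. length v = n \<and> set v \<subseteq> {1..k}}"

text \<open>In a variable word, \<open>None\<close> stands for the variable \<open>x\<close> and \<open>Some a\<close> for the letter \<open>a\<close>.\<close>

definition variable_words :: "nat \<Rightarrow> nat \<Rightarrow> nat option list set" where
  "variable_words k n =
     {w. length w = n \<and> set w \<subseteq> insert None (Some ` {1..k}) \<and> None \<in> set w}"

definition subst_word :: "nat option list \<Rightarrow> nat \<Rightarrow> nat list" where
  "subst_word w a = map (\<lambda>s. case s of None \<Rightarrow> a | Some b \<Rightarrow> b) w"

definition m_lines :: "nat \<Rightarrow> nat \<Rightarrow> nat \<Rightarrow> nat list set set" where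
  "m_lines m k n =
     {subst_word w ` {i + 1..i + m} |w i. w \<in> variable_words k n \<and> i + m \<le> k}"

definition monochromatic :: "(nat list \<Rightarrow> nat) \<Rightarrow> nat \<Rightarrow> nat list set \<Rightarrow> bool" where
  "monochromatic c j L \<longleftrightarrow> (\<forall>v\<in>L. c v = j)"

definition HJ_property :: "nat \<Rightarrow> nat \<Rightarrow> nat \<Rightarrow> bool" where
  "HJ_property k1 k2 n \<longleftrightarrow>
     (\<forall>c \<in> cube (max k1 k2) n \<rightarrow> {1, 2}.
        (\<exists>L \<in> m_lines k1 (max k1 k2) n. monochromatic c 1 L) \<or>
        (\<exists>L \<in> m_lines k2 (max k1 k2) n. monochromatic c 2 L))"

text \<open>The Hales-Jewett theorem guarantees that such an \<open>n\<close> exists when \<open>k1\<close> and \<open>k2\<close> are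
  positive, so that \<open>LEAST\<close> denotes a genuine minimum.\<close>

definition HJ :: "nat \<Rightarrow> nat \<Rightarrow> nat" where
  "HJ k1 k2 = (LEAST n. 0 < n \<and> HJ_property k1 k2 n)"

end

theory Submission
  imports Defs
begin

text \<open>
  Lower bound. For \<open>n < p\<close>, give a word the colour \<open>2\<close> exactly when \<open>p\<close> divides the sum of its
  letters. If \<open>x\<close> occurs \<open>d\<close> times in \<open>w(x)\<close>, then the sum of \<open>w(a)\<close> is an affine function of \<open>a\<close>
  with slope \<open>d\<close>, and \<open>0 < d \<le> n < p\<close> makes \<open>d\<close> invertible modulo \<open>p\<close>. So every line has a point
  of colour \<open>2\<close>, but no two consecutive points of colour \<open>2\<close>
  (\<open>prime_imp_not_HJ_property\<close>).

  Upper bound. This half works for every \<open>k \<ge> 2\<close> in place of \<open>p\<close>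
  (\<open>HJ_property_diagonal_bound\<close>). Suppose that a colouring of \<open>[k]\<^sup>k\<close> has neither a full line of
  colour \<open>1\<close> nor a \<open>2\<close>-line of colour \<open>2\<close>, and let \<open>S\<close> be its set of words of colour \<open>2\<close>. Then \<open>S\<close>
  meets every full line, and among words that differ only by turning some letters \<open>c\<close> into
  \<open>c + 1\<close>, any chain contains at most one element of \<open>S\<close>. The line \<open>x\<dots>x\<close> yields a constant word
  \<open>b\<dots>b\<close> in \<open>S\<close>; choose \<open>c\<close> with \<open>b \<in> {c, c + 1}\<close> and let \<open>b'\<close> be the other of these two letters.
  The \<open>k\<close> full lines given by \<open>x c\<dots>c (c + 1)\<dots>(c + 1)\<close> meet \<open>S\<close> at values \<open>a\<^sub>0, \<dots>, a\<^sub>k\<^sub>-\<^sub>1\<close>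
  of \<open>x\<close>. For a fixed value of \<open>x\<close> their points form a chain, so the \<open>a\<^sub>j\<close> are distinct. At \<open>x = b'\<close>
  their points are words over \<open>{c, c + 1}\<close> comparable to and different from \<open>b\<dots>b\<close>, hence not in
  \<open>S\<close>. So \<open>k\<close> distinct values \<open>a\<^sub>j\<close> lie among the \<open>k - 1\<close> letters other than \<open>b'\<close>, which is absurd.
\<close>

section \<open>The lower bound: colouring by divisibility of the letter sum\<close>

lemma subst_word_in_cube:
  assumes "w \<in> variable_words k n" and "a \<in> {1..k}"
  shows "subst_word w a \<in> cube k n"
  using assms
  by (fastforce simp: variable_words_def cube_def subst_word_def split: option.splits)

lemma sum_list_subst_word:
  "sum_list (subst_word w a) = sum_list (subst_word w 0) + count_list w None * a"
  by (induction w) (auto simp: subst_word_def split: option.splits)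

text \<open>The slope \<open>d\<close> is invertible modulo \<open>p\<close>, and \<open>{1..p}\<close> represents every residue class.\<close>

lemma affine_zero_mod_prime:
  fixes p s d :: nat
  assumes "prime p" and "\<not> p dvd d"
  obtains a where "a \<in> {1..p}" and "p dvd s + d * a"
proof -
  have "coprime d p"
    using assms by (metis coprime_commute prime_imp_coprime)
  then have gcd: "gcd d p = 1"
    by simp
  have "d \<noteq> 0"
    using assms(2) by (cases d) auto
  then obtain e q where "d * e = p * q + gcd d p"
    using bezout_nat by blast
  then have bez: "e * d = Suc (q * p)"
    by (simp add: gcd mult.commute)
  \<comment> \<open>As \<open>e\<close> inverts \<open>d\<close>, the wanted residue is \<open>- s * e\<close>; the factor \<open>p - 1\<close> stands for
    \<open>- 1\<close>, and the representative is shifted from \<open>{0..<p}\<close> to \<open>{1..p}\<close>.\<close>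
  define r where "r = (s * e * (p - 1)) mod p"
  define a where "a = (if r = 0 then p else r)"
  have p0: "p > 0"
    using assms(1) prime_gt_0_nat by blast
  have "s + d * (s * e * (p - 1)) = s + s * (e * d) * (p - 1)"
    by (simp only: mult_ac)
  also have "\<dots> = s + s * Suc (q * p) * (p - 1)"
    by (simp only: bez)
  also have "\<dots> = p * (s + s * q * (p - 1))"
    using p0 by (cases p) (auto simp: algebra_simps)
  finally have dvd: "p dvd s + d * (s * e * (p - 1))"
    by simp
  have "a mod p = (s * e * (p - 1)) mod p"
    by (simp add: a_def r_def)
  then have "(s + d * a) mod p = (s + d * (s * e * (p - 1))) mod p"
    by (intro mod_add_cong mod_mult_cong refl)
  then have "p dvd s + d * a"
    using dvd by (simp add: dvd_eq_mod_eq_0)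
  moreover have "a \<in> {1..p}"
    using p0 by (auto simp: a_def r_def less_imp_le)
  ultimately show thesis
    using that by blast
qed

lemma prime_imp_not_HJ_property:
  assumes "prime p" and "n < p"
  shows "\<not> HJ_property p 2 n"
proof
  assume HJ: "HJ_property p 2 n"
  define c :: "nat list \<Rightarrow> nat" where "c = (\<lambda>v. if p dvd sum_list v then 2 else 1)"
  have max: "max p 2 = p"
    using assms(1) prime_ge_2_nat by (simp add: max_absorb1)
  have slope: "\<not> p dvd count_list w None" if "w \<in> variable_words p n" for w
  proof -
    have "count_list w None \<noteq> 0" "count_list w None \<le> n"
      using that count_le_length[of w None] by (auto simp: variable_words_def count_list_0_iff)
    then show ?thesis
      using assms(2) by (auto dest!: dvd_imp_le)
  qed
  have "(\<exists>L \<in> m_lines p p n. monochromatic c 1 L) \<or> (\<exists>L \<in> m_lines 2 p n. monochromatic c 2 L)"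
    using HJ unfolding HJ_property_def max by (auto simp: c_def)
  then show False
  proof (elim disjE bexE)
    fix L assume "L \<in> m_lines p p n" and mono: "monochromatic c 1 L"
    then obtain w where w: "w \<in> variable_words p n" and L: "L = subst_word w ` {1..p}"
      by (auto simp: m_lines_def)
    obtain a where "a \<in> {1..p}" and
      "p dvd sum_list (subst_word w 0) + count_list w None * a"
      using affine_zero_mod_prime[OF assms(1) slope[OF w]] by blast
    then have "subst_word w a \<in> L" "c (subst_word w a) = 2"
      by (auto simp: L c_def sum_list_subst_word[of w a])
    then show False
      using mono by (auto simp: monochromatic_def)
  next
    fix L assume "L \<in> m_lines 2 p n" and mono: "monochromatic c 2 L"
    then obtain w i where w: "w \<in> variable_words p n" and L: "L = subst_word w ` {i + 1..i + 2}"
      by (auto simp: m_lines_def)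
    have "c (subst_word w (i + 1)) = 2" "c (subst_word w (i + 2)) = 2"
      using mono by (auto simp: L monochromatic_def)
    then have "p dvd sum_list (subst_word w (i + 1))"
      and "p dvd sum_list (subst_word w (i + 1)) + count_list w None"
      by (simp_all add: c_def sum_list_subst_word[of w "i + 1"] sum_list_subst_word[of w "i + 2"]
          sum_list_subst_word[of w "Suc i"] sum_list_subst_word[of w "Suc (Suc i)"]
          algebra_simps split: if_splits)
    then have "p dvd count_list w None"
      by (simp add: dvd_add_right_iff)
    then show False
      using slope[OF w] by simp
  qed
qed

section \<open>The upper bound: counting along a staircase of lines\<close>

definition staircase_word :: "nat \<Rightarrow> nat \<Rightarrow> nat \<Rightarrow> nat option list" where
  "staircase_word n c j = None # replicate (n - 1 - j) (Some c) @ replicate j (Some (Suc c))"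

lemma staircase_word_variable_word:
  assumes "j < n" and "c \<in> {1..<k}"
  shows "staircase_word n c j \<in> variable_words k n"
  using assms by (auto simp: staircase_word_def variable_words_def)

text \<open>For a fixed value of \<open>x\<close>, the points of the staircase lines form a chain: any two of them are
  joined by a \<open>2\<close>-line whose variable occupies the block of letters in which they differ.\<close>

lemma staircase_points_two_line:
  assumes "i < j" and "j < n" and "c \<in> {1..<k}" and "a \<in> {1..k}"
  obtains w where "w \<in> variable_words k n"
    and "subst_word w c = subst_word (staircase_word n c i) a"
    and "subst_word w (Suc c) = subst_word (staircase_word n c j) a"
proof
  let ?w = "Some a # replicate (n - 1 - j) (Some c) @ replicate (j - i) None
    @ replicate i (Some (Suc c))"
  have split: "replicate (n - Suc i) y = replicate (n - Suc j) y @ replicate (j - i) y"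
    "replicate j y = replicate (j - i) y @ replicate i y" for y :: nat
    using assms(1,2) by (auto simp flip: replicate_add)
  show "?w \<in> variable_words k n"
    using assms by (auto simp: variable_words_def)
  show "subst_word ?w c = subst_word (staircase_word n c i) a"
    by (simp add: subst_word_def staircase_word_def split(1))
  show "subst_word ?w (Suc c) = subst_word (staircase_word n c j) a"
    by (simp add: subst_word_def staircase_word_def split(2))
qed

text \<open>If the constant word at \<open>c\<close> lies in the second colour class, then this and the absence of
  \<open>2\<close>-lines there keep all staircase points at \<open>x = c + 1\<close> out of the class; the lemma after it
  does the same for the constant word at \<open>c + 1\<close> and \<open>x = c\<close>. In both cases the first letter \<open>x\<close> is
  among the letters that change, which guarantees that the two words differ.\<close>

lemma constant_below_staircase_point:
  assumes "j < n" and "c \<in> {1..<k}"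
  obtains w where "w \<in> variable_words k n"
    and "subst_word w c = replicate n c"
    and "subst_word w (Suc c) = subst_word (staircase_word n c j) (Suc c)"
proof
  let ?w = "None # replicate (n - 1 - j) (Some c) @ replicate j None"
  have "replicate n c = replicate (1 + (n - 1 - j) + j) c"
    using assms(1) by simp
  then show "subst_word ?w c = replicate n c"
    unfolding replicate_add by (simp add: subst_word_def)
  show "?w \<in> variable_words k n"
    using assms by (auto simp: variable_words_def)
  show "subst_word ?w (Suc c) = subst_word (staircase_word n c j) (Suc c)"
    by (simp add: subst_word_def staircase_word_def)
qed

lemma constant_above_staircase_point:
  assumes "j < n" and "c \<in> {1..<k}"
  obtains w where "w \<in> variable_words k n"
    and "subst_word w c = subst_word (staircase_word n c j) c"
    and "subst_word w (Suc c) = replicate n (Suc c)"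
proof
  let ?w = "None # replicate (n - 1 - j) None @ replicate j (Some (Suc c))"
  have "replicate n (Suc c) = replicate (1 + (n - 1 - j) + j) (Suc c)"
    using assms(1) by simp
  then show "subst_word ?w (Suc c) = replicate n (Suc c)"
    unfolding replicate_add by (simp add: subst_word_def)
  show "?w \<in> variable_words k n"
    using assms by (auto simp: variable_words_def)
  show "subst_word ?w c = subst_word (staircase_word n c j) c"
    by (simp add: subst_word_def staircase_word_def)
qed

text \<open>Here \<open>S\<close> plays the role of the second colour class: \<open>k\<close> staircase lines need \<open>k\<close> distinct
  values of \<open>x\<close> in order to meet \<open>S\<close>, but the constant word in \<open>S\<close> forbids one of the \<open>k\<close> values.\<close>

lemma hitting_set_contains_two_line:
  assumes k: "k \<ge> 2"
    and hit: "\<And>w. w \<in> variable_words k k \<Longrightarrow> \<exists>a \<in> {1..k}. subst_word w a \<in> S"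
  shows "\<exists>w \<in> variable_words k k. \<exists>c \<in> {1..<k}. subst_word w c \<in> S \<and> subst_word w (Suc c) \<in> S"
proof (rule ccontr)
  assume "\<not> ?thesis"
  then have free: "\<not> (subst_word w c \<in> S \<and> subst_word w (Suc c) \<in> S)"
    if "w \<in> variable_words k k" "c \<in> {1..<k}" for w c
    using that by blast
  have "replicate k None \<in> variable_words k k"
    using k by (auto simp: variable_words_def)
  then obtain b where b: "b \<in> {1..k}" "replicate k b \<in> S"
    using hit[of "replicate k None"] by (auto simp: subst_word_def)
  have "\<exists>c b'. c \<in> {1..<k} \<and> b' \<in> {1..k} \<and>
    (\<forall>j<k. subst_word (staircase_word k c j) b' \<notin> S)"
  proof (cases "b < k")
    case True
    then have c: "b \<in> {1..<k}"
      using b by simp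
    have "subst_word (staircase_word k b j) (Suc b) \<notin> S" if "j < k" for j
      using constant_below_staircase_point[OF that c] free[OF _ c] b(2) by metis
    then show ?thesis
      using c by (intro exI[of _ b] exI[of _ "Suc b"]) auto
  next
    \<comment> \<open>Here \<open>b = k\<close>, which has no successor, so \<open>b\<close> becomes the upper letter.\<close>
    case False
    then obtain c where bc: "b = Suc c" and c: "c \<in> {1..<k}"
      using b k by (cases b) auto
    have "subst_word (staircase_word k c j) c \<notin> S" if "j < k" for j
      using constant_above_staircase_point[OF that c] free[OF _ c] b(2) bc by metis
    then show ?thesis
      using c by (intro exI[of _ c]) auto
  qed
  then obtain c b' where c: "c \<in> {1..<k}" and b': "b' \<in> {1..k}"
    and avoid: "\<And>j. j < k \<Longrightarrow> subst_word (staircase_word k c j) b' \<notin> S"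
    by blast
  have "\<forall>j \<in> {..<k}. \<exists>a \<in> {1..k}. subst_word (staircase_word k c j) a \<in> S"
    using hit staircase_word_variable_word[OF _ c] by blast
  then obtain h where h: "\<And>j. j < k \<Longrightarrow> h j \<in> {1..k}"
    and hS: "\<And>j. j < k \<Longrightarrow> subst_word (staircase_word k c j) (h j) \<in> S"
    by (metis lessThan_iff)
  have neq: "h i \<noteq> h j" if ij: "i < j" "j < k" for i j
  proof
    assume eq: "h i = h j"
    have "i < k"
      using ij by simp
    obtain w where "w \<in> variable_words k k"
      "subst_word w c = subst_word (staircase_word k c i) (h j)"
      "subst_word w (Suc c) = subst_word (staircase_word k c j) (h j)"
      using staircase_points_two_line[OF ij c h[OF ij(2)]] by blast
    then show False
      using free[OF _ c] hS[OF \<open>i < k\<close>] hS[OF ij(2)] eq by metis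
  qed
  have "inj_on h {..<k}"
    by (rule linorder_inj_onI) (use neq in auto)
  moreover have "h ` {..<k} \<subseteq> {1..k} - {b'}"
    using h hS avoid by fastforce
  ultimately have "k \<le> card ({1..k} - {b'})"
    by (metis card_inj_on_le card_lessThan finite_Diff finite_atLeastAtMost)
  then show False
    using b' k by simp
qed

lemma HJ_property_diagonal_bound:
  assumes "k \<ge> 2"
  shows "HJ_property k 2 k"
proof -
  have max: "max k 2 = k"
    using assms by simp
  have "\<exists>L \<in> m_lines 2 k k. monochromatic c 2 L"
    if c: "c \<in> cube k k \<rightarrow> {1, 2}" and no: "\<not> (\<exists>L \<in> m_lines k k k. monochromatic c 1 L)" for c
  proof -
    have "\<exists>a \<in> {1..k}. subst_word w a \<in> {v. c v = 2}" if w: "w \<in> variable_words k k" for w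
    proof -
      have "0 + k \<le> k"
        by simp
      then have "subst_word w ` {0 + 1..0 + k} \<in> m_lines k k k"
        unfolding m_lines_def using w by blast
      then have "\<not> monochromatic c 1 (subst_word w ` {0 + 1..0 + k})"
        using no by blast
      then obtain a where a: "a \<in> {1..k}" "c (subst_word w a) \<noteq> 1"
        by (auto simp: monochromatic_def)
      have "c (subst_word w a) \<in> {1, 2}"
        using c subst_word_in_cube[OF w a(1)] by (rule funcset_mem)
      then show ?thesis
        using a by auto
    qed
    then obtain w a where w: "w \<in> variable_words k k" and a: "a \<in> {1..<k}"
      and 2: "c (subst_word w a) = 2" "c (subst_word w (Suc a)) = 2"
      using hitting_set_contains_two_line[OF assms, of "{v. c v = 2}"] by blast
    obtain i where i: "a = i + 1"
      using a by (cases a) auto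
    then have "i + 2 \<le> k"
      using a by simp
    then have "subst_word w ` {i + 1..i + 2} \<in> m_lines 2 k k"
      unfolding m_lines_def using w by blast
    moreover have "{i + 1..i + 2} = {a, Suc a}"
      using i by auto
    ultimately have "subst_word w ` {a, Suc a} \<in> m_lines 2 k k"
      by simp
    moreover have "monochromatic c 2 (subst_word w ` {a, Suc a})"
      using 2 by (simp add: monochromatic_def)
    ultimately show ?thesis
      by blast
  qed
  then show ?thesis
    unfolding HJ_property_def max by blast
qed

theorem corollary16:
  fixes p :: nat
  assumes "prime p"
  shows "HJ p 2 = p"
  unfolding HJ_def
proof (rule Least_equality)
  show "0 < p \<and> HJ_property p 2 p"
    using assms HJ_property_diagonal_bound prime_gt_0_nat prime_ge_2_nat by blast
  show "p \<le> n" if "0 < n \<and> HJ_property p 2 n" for n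
    using that prime_imp_not_HJ_property[OF assms] by (meson not_le)
qed

end
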